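(* (1) There is no LTL formula $\varphi$ such that, for $\star=s$ or for $\star=a$, for all teams $T$: $T\models_\star\varphi$ iff $T\models\exists\pi.\,p_\pi$ (HyperLTL). (2) There is no HyperLTL sentence $\phi$ such that for all teams $T$: $T\models\phi$ iff $T\models_s Fp$. (3) LTL under asynchronous team semantics is exactly as expressive as $\forall$-HyperLTL: for every LTL formula $\varphi$ there is a $\forall$-HyperLTL sentence $\phi$ with $T\models_a\varphi\iff T\models\phi$ for all teams $T$, and for every $\forall$-HyperLTL sentence $\phi$ there is an LTL formula $\varphi$ with the same property.
   Context: Fix a finite set $AP$ with $p\in AP$. Traces are elements of $(2^{AP})^\omega$, $t[i,\infty)=t(i)t(i+1)\cdots$; teams are sets of traces, $T[i,\infty)=\{t[i,\infty):t\in T\}$, $T[k]=\{t[k(t),\infty):t\in T\}$ for $k:T\to\mathbb N$. LTL formulas: $\varphi::=p\mid\neg p\mid\varphi\wedge\varphi\mid\varphi\vee\varphi\mid X\varphi\mid F\varphi\mid G\varphi\mid\varphi U\varphi\mid\varphi R\varphi$. Team semantics $\models_\star$, $\star\in\{a,s\}$: $T\models_\star p$ iff $p\in t(0)$ for all $t\in T$; $T\models_\star\neg p$ iff $p\notin t(0)$ for all $t\in T$; $\wedge$ conjunctive; $T\models_\star\psi\vee\varphi$ iff $T=T_1\cup T_2$ with $T_1\models_\star\psi$, $T_2\models_\star\varphi$; $T\models_\star X\varphi$ iff $T[1,\infty)\models_\star\varphi$. Synchronous: $T\models_s F\varphi$ iff $\exists k$: $T[k,\infty)\models_s\varphi$;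 $G$: $\forall k$; $T\models_s\psi U\varphi$ iff $\exists k$: $T[k,\infty)\models_s\varphi$ and $\forall k'<k$: $T[k',\infty)\models_s\psi$; $T\models_s\psi R\varphi$ iff $\forall k$: $T[k,\infty)\models_s\varphi$ or $\exists k'<k$: $T[k',\infty)\models_s\psi$. Asynchronous: $T\models_a F\varphi$ iff $\exists k:T\to\mathbb N$ with $T[k]\models_a\varphi$; $T\models_a G\varphi$ iff $T[k]\models_a\varphi$ for all $k$; $T\models_a\psi U\varphi$ iff there is $k$ with $T[k]\models_a\varphi$ such that for $T_>=\{t:k(t)>0\}$ and all $k':T_>\to\mathbb N$, $k'<k$ pointwise, $\{t[k'(t),\infty):t\in T_>\}\models_a\psi$; $T\models_a\psi R\varphi$ iff for every $k:T\to\mathbb N$ there are $T_1\cup T_2=T$ with $\{t[k(t),\infty):t\in T_1\}\models_a\varphi$ and some $k':T_2\to\mathbb N$, $k'<k$ pointwise, with $\{t[k'(t),\infty):t\in T_2\}\models_a\psi$. HyperLTL: formulas $\phi::=\exists\pi.\phi\mid\forall\pi.\phi\mid\psi$, $\psi::=p_\pi\mid\neg\psi\mid\psi\vee\psi\mid X\psi\mid\psi U\psi$, with $p\in AP$ and $\pi$ from a countable set of trace variables; a sentence has no free trace variables. For a team $T$ and a partial assignment $\Pi$ of trace variables to traces ($\Pi^i$ maps each $\pi$ to $\Pi(\pi)[i,\infty)$): $(T,\Pi)\models p_\pi$ iff $p\in\Pi(\pi)(0)$; $\neg,\vee$ classical; $(T,\Pi)\models X\psi$ iff $(T,\Pi^1)\models\psi$;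 $(T,\Pi)\models\psi_1U\psi_2$ iff $\exists k$: $(T,\Pi^k)\models\psi_2$ and $\forall k'<k$: $(T,\Pi^{k'})\models\psi_1$; $(T,\Pi)\models\exists\pi.\psi$ iff for some $t\in T$, $(T,\Pi[\pi\mapsto t])\models\psi$; $\forall$ dually. $T\models\phi$ means $(T,\Pi_\emptyset)\models\phi$ for the empty assignment. $\forall$-HyperLTL is the set of sentences $\forall\pi.\psi$ with $\psi$ quantifier-free. *)

theory Defs
  imports Main
begin

text \<open>Atomic propositions form a finite type 'a; a trace is an element of (2^AP)^omega.\<close>

type_synonym 'a trace = "nat \<Rightarrow> 'a set"

definition tsuf :: "nat \<Rightarrow> 'a trace \<Rightarrow> 'a trace" where
  "tsuf i t = (\<lambda>n. t (n + i))"

definition tshift :: "nat \<Rightarrow> 'a trace set \<Rightarrow> 'a trace set" where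
  "tshift i T = tsuf i ` T"

text \<open>T[k] for k : T -> nat (only the values of k on T matter)\<close>
definition tshiftk :: "('a trace \<Rightarrow> nat) \<Rightarrow> 'a trace set \<Rightarrow> 'a trace set" where
  "tshiftk k T = (\<lambda>t. tsuf (k t) t) ` T"

datatype 'a ltl =
    LProp 'a
  | LNProp 'a
  | LAnd "'a ltl" "'a ltl"
  | LOr "'a ltl" "'a ltl"
  | LX "'a ltl"
  | LF "'a ltl"
  | LG "'a ltl"
  | LU "'a ltl" "'a ltl"
  | LR "'a ltl" "'a ltl"

fun sat_s :: "'a trace set \<Rightarrow> 'a ltl \<Rightarrow> bool" where
  "sat_s T (LProp q) = (\<forall>t\<in>T. q \<in> t 0)"
| "sat_s T (LNProp q) = (\<forall>t\<in>T. q \<notin> t 0)"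
| "sat_s T (LAnd \<psi> \<phi>) = (sat_s T \<psi> \<and> sat_s T \<phi>)"
| "sat_s T (LOr \<psi> \<phi>) = (\<exists>T1 T2. T = T1 \<union> T2 \<and> sat_s T1 \<psi> \<and> sat_s T2 \<phi>)"
| "sat_s T (LX \<phi>) = sat_s (tshift 1 T) \<phi>"
| "sat_s T (LF \<phi>) = (\<exists>k. sat_s (tshift k T) \<phi>)"
| "sat_s T (LG \<phi>) = (\<forall>k. sat_s (tshift k T) \<phi>)"
| "sat_s T (LU \<psi> \<phi>) = (\<exists>k. sat_s (tshift k T) \<phi> \<and> (\<forall>k'<k. sat_s (tshift k' T) \<psi>))"
| "sat_s T (LR \<psi> \<phi>) = (\<forall>k. sat_s (tshift k T) \<phi> \<or> (\<exists>k'<k. sat_s (tshift k' T) \<psi>))"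

fun sat_a :: "'a trace set \<Rightarrow> 'a ltl \<Rightarrow> bool" where
  "sat_a T (LProp q) = (\<forall>t\<in>T. q \<in> t 0)"
| "sat_a T (LNProp q) = (\<forall>t\<in>T. q \<notin> t 0)"
| "sat_a T (LAnd \<psi> \<phi>) = (sat_a T \<psi> \<and> sat_a T \<phi>)"
| "sat_a T (LOr \<psi> \<phi>) = (\<exists>T1 T2. T = T1 \<union> T2 \<and> sat_a T1 \<psi> \<and> sat_a T2 \<phi>)"
| "sat_a T (LX \<phi>) = sat_a (tshift 1 T) \<phi>"
| "sat_a T (LF \<phi>) = (\<exists>k. sat_a (tshiftk k T) \<phi>)"
| "sat_a T (LG \<phi>) = (\<forall>k. sat_a (tshiftk k T) \<phi>)"
| "sat_a T (LU \<psi> \<phi>) = (\<exists>k. sat_a (tshiftk k T) \<phi> \<and>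
      (\<forall>k'. (\<forall>t\<in>{t\<in>T. 0 < k t}. k' t < k t) \<longrightarrow> sat_a (tshiftk k' {t\<in>T. 0 < k t}) \<psi>))"
| "sat_a T (LR \<psi> \<phi>) = (\<forall>k. \<exists>T1 T2. T1 \<union> T2 = T \<and> sat_a (tshiftk k T1) \<phi> \<and>
      (\<exists>k'. (\<forall>t\<in>T2. k' t < k t) \<and> sat_a (tshiftk k' T2) \<psi>))"

datatype 'a hbody =
    HProp 'a nat
  | HNeg "'a hbody"
  | HOr "'a hbody" "'a hbody"
  | HX "'a hbody"
  | HU "'a hbody" "'a hbody"

datatype 'a hyper =
    HEx nat "'a hyper"
  | HAll nat "'a hyper"
  | HBody "'a hbody"

type_synonym 'a assignment = "nat \<Rightarrow> 'a trace option"

definition ashift :: "nat \<Rightarrow> 'a assignment \<Rightarrow> 'a assignment" where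
  "ashift i \<Pi> = (\<lambda>\<pi>. map_option (tsuf i) (\<Pi> \<pi>))"

fun hsat_b :: "'a trace set \<Rightarrow> 'a assignment \<Rightarrow> 'a hbody \<Rightarrow> bool" where
  "hsat_b T \<Pi> (HProp q \<pi>) = (case \<Pi> \<pi> of Some t \<Rightarrow> q \<in> t 0 | None \<Rightarrow> False)"
| "hsat_b T \<Pi> (HNeg \<psi>) = (\<not> hsat_b T \<Pi> \<psi>)"
| "hsat_b T \<Pi> (HOr \<psi>1 \<psi>2) = (hsat_b T \<Pi> \<psi>1 \<or> hsat_b T \<Pi> \<psi>2)"
| "hsat_b T \<Pi> (HX \<psi>) = hsat_b T (ashift 1 \<Pi>) \<psi>"
| "hsat_b T \<Pi> (HU \<psi>1 \<psi>2) = (\<exists>k. hsat_b T (ashift k \<Pi>) \<psi>2 \<and> (\<forall>k'<k. hsat_b T (ashift k' \<Pi>) \<psi>1))"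

fun hsat :: "'a trace set \<Rightarrow> 'a assignment \<Rightarrow> 'a hyper \<Rightarrow> bool" where
  "hsat T \<Pi> (HEx \<pi> \<phi>) = (\<exists>t\<in>T. hsat T (\<Pi>(\<pi> := Some t)) \<phi>)"
| "hsat T \<Pi> (HAll \<pi> \<phi>) = (\<forall>t\<in>T. hsat T (\<Pi>(\<pi> := Some t)) \<phi>)"
| "hsat T \<Pi> (HBody \<psi>) = hsat_b T \<Pi> \<psi>"

definition hmodels :: "'a trace set \<Rightarrow> 'a hyper \<Rightarrow> bool" where
  "hmodels T \<phi> = hsat T (\<lambda>_. None) \<phi>"

fun fv_b :: "'a hbody \<Rightarrow> nat set" where
  "fv_b (HProp q \<pi>) = {\<pi>}"
| "fv_b (HNeg \<psi>) = fv_b \<psi>"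
| "fv_b (HOr \<psi>1 \<psi>2) = fv_b \<psi>1 \<union> fv_b \<psi>2"
| "fv_b (HX \<psi>) = fv_b \<psi>"
| "fv_b (HU \<psi>1 \<psi>2) = fv_b \<psi>1 \<union> fv_b \<psi>2"

fun fv :: "'a hyper \<Rightarrow> nat set" where
  "fv (HEx \<pi> \<phi>) = fv \<phi> - {\<pi>}"
| "fv (HAll \<pi> \<phi>) = fv \<phi> - {\<pi>}"
| "fv (HBody \<psi>) = fv_b \<psi>"

definition hsentence :: "'a hyper \<Rightarrow> bool" where
  "hsentence \<phi> \<longleftrightarrow> fv \<phi> = {}"

definition forall_hyper :: "'a hyper \<Rightarrow> bool" where
  "forall_hyper \<phi> \<longleftrightarrow> hsentence \<phi> \<and> (\<exists>\<pi> \<psi>. \<phi> = HAll \<pi> (HBody \<psi>))"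

end

theory Submission
  imports Defs "HOL-Library.Omega_Words_Fun"
begin

text \<open>
  The empty team satisfies every LTL formula under both team semantics, but no existential
  sentence. Asynchronous team semantics is flat: a team satisfies a formula iff each of its traces
  does in the classical sense; so it coincides with a single universal trace quantifier.

  For the inexpressibility of synchronous \<open>F p\<close>, encode a team of \<open>K\<close> traces by a
  word over sets of colours below \<open>K\<close>: the letter at a position is the set of those traces at
  which \<open>p\<close> fails there. A prenex sentence with fewer than \<open>K\<close> quantifiers only ever
  inspects words from which some colour has been erased, and its body cannot distinguish
  \<open>x\<^sup>N\<close> from \<open>x\<^sup>N\<^sup>+\<^sup>1\<close>, for \<open>N\<close> large. Hence it suffices to find a word \<open>u\<close> without empty
  letters and a word \<open>u'\<close> with an empty letter that can be identified by such
  pumping steps as soon as any one colour is erased. These are built by recursion on \<open>K\<close>: from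
  \<open>(A, E)\<close> pass to \<open>(A\<^sup>N B\<^sup>N, A\<^sup>N E B\<^sup>N)\<close>, where \<open>B\<close> is \<open>E\<close> with the empty letters
  replaced by the new colour. Erasing an old colour identifies \<open>E\<close> with \<open>A\<close>, and erasing the
  new one identifies \<open>E\<close> with \<open>B\<close>.
\<close>

section \<open>Flatness of asynchronous team semantics\<close>

lemma sat_s_empty: "sat_s {} \<phi>"
  by (induction \<phi>) (auto simp: tshift_def)

lemma sat_a_empty: "sat_a {} \<phi>"
  by (induction \<phi>) (auto simp: tshift_def tshiftk_def)

lemma tsuf_tsuf: "tsuf i (tsuf j t) = tsuf (i + j) t"
  by (simp add: tsuf_def add.assoc)

fun trace_sat :: "'a trace \<Rightarrow> 'a ltl \<Rightarrow> bool" where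
  "trace_sat t (LProp q) = (q \<in> t 0)"
| "trace_sat t (LNProp q) = (q \<notin> t 0)"
| "trace_sat t (LAnd \<psi> \<phi>) = (trace_sat t \<psi> \<and> trace_sat t \<phi>)"
| "trace_sat t (LOr \<psi> \<phi>) = (trace_sat t \<psi> \<or> trace_sat t \<phi>)"
| "trace_sat t (LX \<phi>) = trace_sat (tsuf 1 t) \<phi>"
| "trace_sat t (LF \<phi>) = (\<exists>k. trace_sat (tsuf k t) \<phi>)"
| "trace_sat t (LG \<phi>) = (\<forall>k. trace_sat (tsuf k t) \<phi>)"
| "trace_sat t (LU \<psi> \<phi>) = (\<exists>k. trace_sat (tsuf k t) \<phi> \<and> (\<forall>k'<k. trace_sat (tsuf k' t) \<psi>))"
| "trace_sat t (LR \<psi> \<phi>) = (\<forall>k. trace_sat (tsuf k t) \<phi> \<or> (\<exists>k'<k. trace_sat (tsuf k' t) \<psi>))"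

text \<open>Asynchronous operators advance traces independently: a function \<open>k\<close> on the
  team is a separate offset for each trace, and choice assembles such functions from the witnesses
  of the single traces. Disjunction sorts the traces by the disjunct they satisfy.\<close>

lemma sat_a_flat: "sat_a T \<phi> \<longleftrightarrow> (\<forall>t\<in>T. trace_sat t \<phi>)"
proof (induction \<phi> arbitrary: T)
  case (LOr \<psi> \<phi>)
  show ?case
  proof
    assume "sat_a T (LOr \<psi> \<phi>)"
    then obtain T1 T2 where "T = T1 \<union> T2" "sat_a T1 \<psi>" "sat_a T2 \<phi>" by auto
    then show "\<forall>t\<in>T. trace_sat t (LOr \<psi> \<phi>)" using LOr.IH[of T1] LOr.IH[of T2] by simp blast
  next
    assume "\<forall>t\<in>T. trace_sat t (LOr \<psi> \<phi>)"
    then have "T = {t\<in>T. trace_sat t \<psi>} \<union> {t\<in>T. trace_sat t \<phi>}" by auto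
    moreover have "sat_a {t\<in>T. trace_sat t \<psi>} \<psi>" "sat_a {t\<in>T. trace_sat t \<phi>} \<phi>"
      by (simp_all add: LOr.IH)
    ultimately show "sat_a T (LOr \<psi> \<phi>)" by (simp only: sat_a.simps) blast
  qed
next
  case (LF \<phi>)
  show ?case
    using bchoice_iff[of T "\<lambda>t k. trace_sat (tsuf k t) \<phi>"] by (simp add: LF.IH tshiftk_def)
next
  case (LG \<phi>)
  have "trace_sat (tsuf n t) \<phi>"
    if "\<forall>k. \<forall>t\<in>T. trace_sat (tsuf (k t) t) \<phi>" "t \<in> T" for n t
    using that(1)[rule_format, of t "\<lambda>_. n"] that(2) by simp
  then show ?case by (auto simp: LG.IH tshiftk_def)
next
  case (LU \<psi> \<phi>)
  show ?case
  proof
    assume "sat_a T (LU \<psi> \<phi>)"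
    then obtain k where k: "\<forall>t\<in>T. trace_sat (tsuf (k t) t) \<phi>"
      and k': "\<And>k'. \<forall>t\<in>T. 0 < k t \<longrightarrow> k' t < k t \<Longrightarrow>
                 \<forall>t\<in>T. 0 < k t \<longrightarrow> trace_sat (tsuf (k' t) t) \<psi>"
      by (auto simp: LU.IH tshiftk_def)
    have "trace_sat (tsuf j t) \<psi>" if t: "t \<in> T" and j: "j < k t" for t j
    proof -
      \<comment> \<open>To test position \<open>j\<close> of \<open>t\<close> alone, all other
        traces stay at 0, which is admissible because only traces with positive \<open>k\<close> are
        constrained.\<close>
      have "\<forall>s\<in>T. 0 < k s \<longrightarrow> (if s = t then j else 0) < k s" using j by simp
      from k'[OF this] have "0 < k t \<longrightarrow> trace_sat (tsuf (if t = t then j else 0) t) \<psi>"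
        using t by (rule bspec)
      then show ?thesis using j by simp
    qed
    with k show "\<forall>t\<in>T. trace_sat t (LU \<psi> \<phi>)" by auto
  next
    assume "\<forall>t\<in>T. trace_sat t (LU \<psi> \<phi>)"
    then obtain k where
      "\<forall>t\<in>T. trace_sat (tsuf (k t) t) \<phi> \<and> (\<forall>k'<k t. trace_sat (tsuf k' t) \<psi>)"
      using bchoice[of T "\<lambda>t k. trace_sat (tsuf k t) \<phi> \<and> (\<forall>k'<k. trace_sat (tsuf k' t) \<psi>)"]
      by auto
    then show "sat_a T (LU \<psi> \<phi>)"
      by (auto simp: LU.IH tshiftk_def intro!: exI[of _ k])
  qed
next
  case (LR \<psi> \<phi>)
  show ?case
  proof
    assume T: "sat_a T (LR \<psi> \<phi>)"
    show "\<forall>t\<in>T. trace_sat t (LR \<psi> \<phi>)"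
    proof
      fix t assume "t \<in> T"
      have "trace_sat (tsuf k t) \<phi> \<or> (\<exists>k'<k. trace_sat (tsuf k' t) \<psi>)" for k
      proof -
        obtain T1 T2 k' where "T1 \<union> T2 = T" "sat_a (tshiftk (\<lambda>_. k) T1) \<phi>"
          "\<forall>t\<in>T2. k' t < k" "sat_a (tshiftk k' T2) \<psi>"
          using T[unfolded sat_a.simps, rule_format, of "\<lambda>_. k"] by blast
        with \<open>t \<in> T\<close> show ?thesis by (auto simp: LR.IH tshiftk_def)
      qed
      then show "trace_sat t (LR \<psi> \<phi>)" by simp
    qed
  next
    assume T: "\<forall>t\<in>T. trace_sat t (LR \<psi> \<phi>)"
    have "\<exists>T1 T2. T1 \<union> T2 = T \<and> sat_a (tshiftk k T1) \<phi> \<and>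
      (\<exists>k'. (\<forall>t\<in>T2. k' t < k t) \<and> sat_a (tshiftk k' T2) \<psi>)" for k
    proof -
      \<comment> \<open>Traces outside \<open>?T1\<close> violate \<phi> at their offset, so release
        gives each of them an earlier position satisfying \<psi>.\<close>
      let ?T1 = "{t\<in>T. trace_sat (tsuf (k t) t) \<phi>}"
      have "\<forall>t\<in>T - ?T1. \<exists>j. j < k t \<and> trace_sat (tsuf j t) \<psi>" using T by auto
      from bchoice[OF this] obtain k' where
        "\<forall>t\<in>T - ?T1. k' t < k t \<and> trace_sat (tsuf (k' t) t) \<psi>" by blast
      then show ?thesis
        by (intro exI[of _ ?T1] exI[of _ "T - ?T1"]) (auto simp: LR.IH tshiftk_def)
    qed
    then show "sat_a T (LR \<psi> \<phi>)" by simp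
  qed
qed (auto simp: tshift_def)

section \<open>Asynchronous LTL and universal HyperLTL\<close>

text \<open>Bodies have no constants, but F and G become untils with a trivially true left argument.
  Variable 0 is the one bound in the translation, so no further free variable arises.\<close>

definition htrue :: "'a \<Rightarrow> 'a hbody" where
  "htrue p = HOr (HProp p 0) (HNeg (HProp p 0))"

lemma hsat_b_htrue [simp]: "hsat_b T \<Pi> (htrue p)"
  by (simp add: htrue_def)

fun hbody_of_ltl :: "'a \<Rightarrow> 'a ltl \<Rightarrow> 'a hbody" where
  "hbody_of_ltl p (LProp q) = HProp q 0"
| "hbody_of_ltl p (LNProp q) = HNeg (HProp q 0)"
| "hbody_of_ltl p (LAnd \<psi> \<phi>) = HNeg (HOr (HNeg (hbody_of_ltl p \<psi>)) (HNeg (hbody_of_ltl p \<phi>)))"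
| "hbody_of_ltl p (LOr \<psi> \<phi>) = HOr (hbody_of_ltl p \<psi>) (hbody_of_ltl p \<phi>)"
| "hbody_of_ltl p (LX \<phi>) = HX (hbody_of_ltl p \<phi>)"
| "hbody_of_ltl p (LF \<phi>) = HU (htrue p) (hbody_of_ltl p \<phi>)"
| "hbody_of_ltl p (LG \<phi>) = HNeg (HU (htrue p) (HNeg (hbody_of_ltl p \<phi>)))"
| "hbody_of_ltl p (LU \<psi> \<phi>) = HU (hbody_of_ltl p \<psi>) (hbody_of_ltl p \<phi>)"
| "hbody_of_ltl p (LR \<psi> \<phi>) = HNeg (HU (HNeg (hbody_of_ltl p \<psi>)) (HNeg (hbody_of_ltl p \<phi>)))"

lemma ashift_Some: "\<Pi> \<pi> = Some t \<Longrightarrow> ashift k \<Pi> \<pi> = Some (tsuf k t)"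
  by (simp add: ashift_def)

lemma hsat_b_hbody_of_ltl:
  "\<Pi> 0 = Some t \<Longrightarrow> hsat_b T \<Pi> (hbody_of_ltl p \<phi>) \<longleftrightarrow> trace_sat t \<phi>"
proof (induction \<phi> arbitrary: \<Pi> t)
qed (auto simp: ashift_Some)

lemma fv_b_hbody_of_ltl: "fv_b (hbody_of_ltl p \<phi>) \<subseteq> {0}"
  by (induction \<phi>) (auto simp: htrue_def)

lemma ltl_to_forall_hyper:
  fixes \<phi> :: "'a ltl"
  shows "\<exists>\<psi>. forall_hyper \<psi> \<and> (\<forall>T. sat_a T \<phi> \<longleftrightarrow> hmodels T \<psi>)"
proof (intro exI conjI allI)
  \<comment> \<open>Any proposition serves in place of \<open>undefined\<close>, as it occurs only
    inside the tautology.\<close>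
  let ?\<psi> = "HAll 0 (HBody (hbody_of_ltl undefined \<phi>))"
  show "forall_hyper ?\<psi>"
    using fv_b_hbody_of_ltl[of undefined \<phi>] by (auto simp: forall_hyper_def hsentence_def)
  show "sat_a T \<phi> \<longleftrightarrow> hmodels T ?\<psi>" for T
    by (simp add: sat_a_flat hmodels_def hsat_b_hbody_of_ltl)
qed

text \<open>The Boolean records the polarity: \<open>False\<close> yields the negation normal form of the negated body.\<close>
fun ltl_of_hbody :: "bool \<Rightarrow> 'a hbody \<Rightarrow> 'a ltl" where
  "ltl_of_hbody b (HProp q \<pi>) = (if b then LProp q else LNProp q)"
| "ltl_of_hbody b (HNeg \<psi>) = ltl_of_hbody (\<not> b) \<psi>"
| "ltl_of_hbody b (HOr \<psi> \<chi>) =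
    (if b then LOr else LAnd) (ltl_of_hbody b \<psi>) (ltl_of_hbody b \<chi>)"
| "ltl_of_hbody b (HX \<psi>) = LX (ltl_of_hbody b \<psi>)"
| "ltl_of_hbody b (HU \<psi> \<chi>) =
    (if b then LU else LR) (ltl_of_hbody b \<psi>) (ltl_of_hbody b \<chi>)"

text \<open>Comparing with \<open>b\<close> treats both polarities in one induction, since negation
  switches between them; release is the dual of until.\<close>

lemma trace_sat_ltl_of_hbody:
  "\<Pi> \<pi> = Some t \<Longrightarrow> fv_b \<psi> \<subseteq> {\<pi>} \<Longrightarrow> trace_sat t (ltl_of_hbody b \<psi>) \<longleftrightarrow> hsat_b T \<Pi> \<psi> = b"
proof (induction \<psi> arbitrary: \<Pi> t b)
  case (HNeg \<psi>)
  then show ?case using HNeg.IH[of \<Pi> t "\<not> b"] by auto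
next
  case (HOr \<psi> \<chi>)
  then show ?case using HOr.IH(1)[of \<Pi> t b] HOr.IH(2)[of \<Pi> t b] by auto
next
  case (HX \<psi>)
  then show ?case using HX.IH[of "ashift 1 \<Pi>" "tsuf 1 t" b] by (simp add: ashift_Some)
next
  case (HU \<psi> \<chi>)
  then show ?case
    using HU.IH(1)[of "ashift k \<Pi>" "tsuf k t" b for k]
      HU.IH(2)[of "ashift k \<Pi>" "tsuf k t" b for k] by (auto simp: ashift_Some)
qed auto

lemma forall_hyper_to_ltl:
  assumes "forall_hyper \<psi>"
  shows "\<exists>\<phi>. \<forall>T. sat_a T \<phi> \<longleftrightarrow> hmodels T \<psi>"
proof -
  obtain \<pi> \<chi> where \<psi>: "\<psi> = HAll \<pi> (HBody \<chi>)" and fv: "fv_b \<chi> \<subseteq> {\<pi>}"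
    using assms by (auto simp: forall_hyper_def hsentence_def)
  have "sat_a T (ltl_of_hbody True \<chi>) \<longleftrightarrow> hmodels T \<psi>" for T
    using trace_sat_ltl_of_hbody[OF _ fv, where b = True]
    by (auto simp: sat_a_flat hmodels_def \<psi>)
  then show ?thesis by blast
qed

section \<open>Bodies cannot count\<close>

definition colour_trace :: "'a \<Rightarrow> nat trace \<Rightarrow> nat \<Rightarrow> 'a trace" where
  "colour_trace p w i = (\<lambda>n. if i \<in> w n then {} else {p})"

definition colour_asg :: "'a \<Rightarrow> (nat \<Rightarrow> nat option) \<Rightarrow> nat trace \<Rightarrow> 'a assignment" where
  "colour_asg p g w = (\<lambda>\<pi>. map_option (colour_trace p w) (g \<pi>))"

text \<open>Because of this, a body under a colour assignment is a temporal property of the single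
  word \<open>w\<close>.\<close>

lemma ashift_colour_asg: "ashift k (colour_asg p g w) = colour_asg p g (tsuf k w)"
proof
  show "ashift k (colour_asg p g w) \<pi> = colour_asg p g (tsuf k w) \<pi>" for \<pi>
    by (cases "g \<pi>") (auto simp: ashift_def colour_asg_def colour_trace_def tsuf_def)
qed

lemma colour_asg_upd:
  "(colour_asg p g w)(\<pi> := Some (colour_trace p w i)) = colour_asg p (g(\<pi> := Some i)) w"
  by (auto simp: colour_asg_def)

lemma colour_asg_erase:
  fixes g :: "nat \<Rightarrow> nat option"
  assumes "j \<notin> ran g" "\<And>n. w n - {j} = w' n - {j}"
  shows "colour_asg p g w = colour_asg p g w'"
proof
  have "colour_trace p w i = colour_trace p w' i" if "i \<noteq> j" for i
  proof -
    have "i \<in> w n \<longleftrightarrow> i \<in> w' n" for n using assms(2)[of n] that by blast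
    then show ?thesis by (simp add: colour_trace_def)
  qed
  moreover have "i \<noteq> j" if "g \<pi> = Some i" for \<pi> i using assms(1) that by (auto simp: ran_def)
  ultimately show "colour_asg p g w \<pi> = colour_asg p g w' \<pi>" for \<pi>
    by (cases "g \<pi>") (simp_all add: colour_asg_def)
qed

text \<open>Atoms count 1, so that a bound \<open>hdepth \<psi> \<le> n\<close> forces at least one
  copy of \<open>x\<close> in \<open>lpow x n\<close>, which fixes the first letter. Temporal
  operators cost one copy each.\<close>

fun hdepth :: "'a hbody \<Rightarrow> nat" where
  "hdepth (HProp q \<pi>) = 1"
| "hdepth (HNeg \<psi>) = hdepth \<psi>"
| "hdepth (HOr \<psi> \<chi>) = max (hdepth \<psi>) (hdepth \<chi>)"
| "hdepth (HX \<psi>) = Suc (hdepth \<psi>)"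
| "hdepth (HU \<psi> \<chi>) = Suc (max (hdepth \<psi>) (hdepth \<chi>))"

abbreviation lpow :: "'b list \<Rightarrow> nat \<Rightarrow> 'b list" where
  "lpow x n \<equiv> concat (replicate n x)"

lemma tsuf_conc: "k \<le> length v \<Longrightarrow> tsuf k (v \<frown> y) = drop k v \<frown> y"
  by (rule ext) (auto simp: tsuf_def conc_def add.commute less_diff_conv)

text \<open>The primed sequences repeat the block of length \<open>d\<close> starting at
  \<open>l\<close>. A witness before \<open>l + d\<close> stays where it is, and a later one moves
  by \<open>d\<close>; the repeated block imposes no new condition.\<close>

lemma until_transfer:
  fixes A A' B B' :: "nat \<Rightarrow> bool"
  assumes "\<And>k. k < l + d \<Longrightarrow> A' k = A k" "\<And>k. k \<ge> l \<Longrightarrow> A' (k + d) = A k"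
    and "\<And>k. k < l + d \<Longrightarrow> B' k = B k" "\<And>k. k \<ge> l \<Longrightarrow> B' (k + d) = B k"
  shows "(\<exists>k. A k \<and> (\<forall>k'<k. B k')) \<longleftrightarrow> (\<exists>k. A' k \<and> (\<forall>k'<k. B' k'))"
proof
  assume "\<exists>k. A k \<and> (\<forall>k'<k. B k')"
  then obtain k where k: "A k" "\<And>k'. k' < k \<Longrightarrow> B k'" by blast
  show "\<exists>k. A' k \<and> (\<forall>k'<k. B' k')"
  proof (cases "k < l + d")
    case True
    then show ?thesis using k assms(1,3) by (intro exI[of _ k]) auto
  next
    case False
    have "B' k'" if "k' < k + d" for k'
    proof (cases "k' < l + d")
      case True
      then show ?thesis using False k(2) assms(3) by auto
    next
      case far: False
      then show ?thesis using assms(4)[of "k' - d"] k(2)[of "k' - d"] that by simp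
    qed
    then show ?thesis using False k(1) assms(2)[of k] by (intro exI[of _ "k + d"]) auto
  qed
next
  assume "\<exists>k. A' k \<and> (\<forall>k'<k. B' k')"
  then obtain k where k: "A' k" "\<And>k'. k' < k \<Longrightarrow> B' k'" by blast
  show "\<exists>k. A k \<and> (\<forall>k'<k. B k')"
  proof (cases "k < l + d")
    case True
    then show ?thesis using k assms(1,3) by (intro exI[of _ k]) auto
  next
    case False
    have "B k'" if "k' < k - d" for k'
    proof (cases "k' < l + d")
      case True
      then show ?thesis using that k(2)[of k'] assms(3) by auto
    next
      case far: False
      then show ?thesis using assms(4)[of k'] k(2)[of "k' + d"] that by simp
    qed
    then show ?thesis using False k(1) assms(2)[of "k - d"] by (intro exI[of _ "k - d"]) auto
  qed
qed

text \<open>The prefix \<open>v\<close> must vary in the induction: a suffix starting in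
  \<open>v\<close> or in the first \<open>x\<close> has the same shape with a new prefix and one
  copy fewer. Suffixes of the longer word from the second copy on are already suffixes of the
  shorter one.\<close>

lemma hsat_b_pump:
  "hdepth \<psi> \<le> n \<Longrightarrow>
   hsat_b T (colour_asg p g (v \<frown> lpow x n \<frown> y)) \<psi> \<longleftrightarrow>
   hsat_b T (colour_asg p g (v \<frown> lpow x (Suc n) \<frown> y)) \<psi>"
proof (induction \<psi> arbitrary: n v)
  case (HProp q \<pi>)
  then obtain m where "n = Suc m" by (cases n) auto
  then have "(v \<frown> lpow x n \<frown> y) 0 = (v \<frown> lpow x (Suc n) \<frown> y) 0"
    by (cases v; cases x) (auto simp: conc_def nth_append)
  then show ?case
    by (cases "g \<pi>") (auto simp: colour_asg_def colour_trace_def)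
next
  case (HX \<psi>)
  then obtain m where n: "n = Suc m" and m: "hdepth \<psi> \<le> m" by (cases n) auto
  show ?case
  \<comment> \<open>If both are empty, the two words are just \<open>y\<close>.\<close>
  proof (cases "v @ x = []")
    case False
    then have *: "tsuf 1 (v \<frown> lpow x (Suc k) \<frown> y) = drop 1 (v @ x) \<frown> lpow x k \<frown> y" for k
      using tsuf_conc[of 1 "v @ x" "lpow x k \<frown> y"] False by (simp add: Suc_le_eq)
    show ?thesis
      using HX.IH[OF m, of "drop 1 (v @ x)"] by (simp only: hsat_b.simps ashift_colour_asg * n)
  qed simp
next
  case (HU \<psi> \<chi>)
  then obtain m where n: "n = Suc m" and m: "hdepth \<psi> \<le> m" "hdepth \<chi> \<le> m" by (cases n) auto
  let ?w = "\<lambda>k. v \<frown> lpow x k \<frown> y"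
  have near: "tsuf k (?w (Suc i)) = drop k (v @ x) \<frown> lpow x i \<frown> y"
    if "k < length v + length x" for k i
    using tsuf_conc[of k "v @ x" "lpow x i \<frown> y"] that by simp
  have far: "tsuf (k + length x) (?w (Suc n)) = tsuf k (?w n)" if "k \<ge> length v" for k
  proof -
    have "tsuf (length v + length x) (?w (Suc n)) = tsuf (length v) (?w n)"
      using tsuf_conc[of "length v + length x" "v @ x" "lpow x n \<frown> y"]
        tsuf_conc[of "length v" v "lpow x n \<frown> y"] by simp
    then have "tsuf (k - length v) (tsuf (length v + length x) (?w (Suc n)))
      = tsuf (k - length v) (tsuf (length v) (?w n))" by simp
    then show ?thesis using that by (simp add: tsuf_tsuf add.commute add.left_commute)
  qed
  show ?case
    unfolding hsat_b.simps ashift_colour_asg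
  proof (rule until_transfer[where l = "length v" and d = "length x"])
    fix k assume k: "k < length v + length x"
    show "hsat_b T (colour_asg p g (tsuf k (?w (Suc n)))) \<chi>
        = hsat_b T (colour_asg p g (tsuf k (?w n))) \<chi>"
      using HU.IH(2)[OF m(2), of "drop k (v @ x)"] by (simp only: near[OF k] n)
    show "hsat_b T (colour_asg p g (tsuf k (?w (Suc n)))) \<psi>
        = hsat_b T (colour_asg p g (tsuf k (?w n))) \<psi>"
      using HU.IH(1)[OF m(1), of "drop k (v @ x)"] by (simp only: near[OF k] n)
  qed (simp_all only: far)
qed auto

section \<open>Words that are indistinguishable once a colour is erased\<close>

text \<open>Quantifying over all surrounding \<open>v\<close> and \<open>y\<close> makes this
  relation a congruence for concatenation.\<close>

definition erase_equiv :: "'a \<Rightarrow> nat \<Rightarrow> nat \<Rightarrow> nat set list \<Rightarrow> nat set list \<Rightarrow> bool" where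
  "erase_equiv p N j u u' \<longleftrightarrow> (\<forall>T g \<psi> v y. j \<notin> ran g \<longrightarrow> hdepth \<psi> \<le> N \<longrightarrow>
     hsat_b T (colour_asg p g (v \<frown> u \<frown> y)) \<psi> = hsat_b T (colour_asg p g (v \<frown> u' \<frown> y)) \<psi>)"

lemma erase_equiv_trans [trans]:
  "erase_equiv p N j u u' \<Longrightarrow> erase_equiv p N j u' u'' \<Longrightarrow> erase_equiv p N j u u''"
  by (simp add: erase_equiv_def)

lemma erase_equiv_context:
  assumes "erase_equiv p N j u u'"
  shows "erase_equiv p N j (a @ u @ b) (a @ u' @ b)"
  unfolding erase_equiv_def
proof (intro allI impI)
  fix T and g :: "nat \<Rightarrow> nat option" and \<psi> :: "'a hbody" and v y
  assume "j \<notin> ran g" "hdepth \<psi> \<le> N"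
  then show "hsat_b T (colour_asg p g (v \<frown> (a @ u @ b) \<frown> y)) \<psi>
    = hsat_b T (colour_asg p g (v \<frown> (a @ u' @ b) \<frown> y)) \<psi>"
    using assms[unfolded erase_equiv_def, rule_format, of g \<psi> T "v @ a" "b \<frown> y"] by simp
qed

lemma erase_equiv_pump: "erase_equiv p N j (lpow x N) (lpow x (Suc N))"
  unfolding erase_equiv_def
proof (intro allI impI)
  fix T and g :: "nat \<Rightarrow> nat option" and \<psi> :: "'a hbody" and v y
  assume "hdepth \<psi> \<le> N"
  then show "hsat_b T (colour_asg p g (v \<frown> lpow x N \<frown> y)) \<psi>
    = hsat_b T (colour_asg p g (v \<frown> lpow x (Suc N) \<frown> y)) \<psi>"
    by (rule hsat_b_pump)
qed

lemma erase_equiv_fill: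
  "erase_equiv p N j (map (\<lambda>s. if s = {} then {j} else s) u) u"
  unfolding erase_equiv_def
proof (intro allI impI)
  fix T and g :: "nat \<Rightarrow> nat option" and \<psi> :: "'a hbody" and v y
  assume "j \<notin> ran g"
  then have "colour_asg p g (v \<frown> map (\<lambda>s. if s = {} then {j} else s) u \<frown> y)
    = colour_asg p g (v \<frown> u \<frown> y)"
    by (rule colour_asg_erase) (auto simp: conc_def)
  then show "hsat_b T (colour_asg p g (v \<frown> map (\<lambda>s. if s = {} then {j} else s) u \<frown> y)) \<psi>
    = hsat_b T (colour_asg p g (v \<frown> u \<frown> y)) \<psi>" by simp
qed

lemma lpow_Suc_right: "lpow x (Suc n) = lpow x n @ x"
  by (induction n) auto

lemma erase_equiv_words:
  "\<exists>u u'. (\<forall>s\<in>set u. s \<noteq> {} \<and> s \<subseteq> {..<K}) \<and> {} \<in> set u' \<and> (\<forall>s\<in>set u'. s \<subseteq> {..<K}) \<and>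
     (\<forall>j<K. erase_equiv p N j u u')"
proof (induction K)
  case 0
  \<comment> \<open>Without colours the equivalence is vacuous.\<close>
  show ?case by (intro exI[of _ "[]"] exI[of _ "[{}]"]) simp
next
  case (Suc K)
  then obtain A E where A: "\<forall>s\<in>set A. s \<noteq> {} \<and> s \<subseteq> {..<K}"
    and E: "{} \<in> set E" "\<forall>s\<in>set E. s \<subseteq> {..<K}"
    and AE: "\<And>j. j < K \<Longrightarrow> erase_equiv p N j A E" by blast
  define B where "B = map (\<lambda>s. if s = {} then {K} else s) E"
  have B: "\<forall>s\<in>set B. s \<noteq> {} \<and> s \<subseteq> {..<Suc K}"
    using E(2) by (fastforce simp: B_def)
  have "erase_equiv p N j (lpow A N @ lpow B N) (lpow A N @ E @ lpow B N)" if "j < Suc K" for j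
  proof (cases "j = K")
    case True
    \<comment> \<open>Pumping supplies an extra \<open>B\<close>, which becomes \<open>E\<close>
      once colour \<open>K\<close> is invisible.\<close>
    have "erase_equiv p N j (lpow A N @ lpow B N) (lpow A N @ B @ lpow B N)"
      using erase_equiv_context[OF erase_equiv_pump[of p N j B], of "lpow A N" "[]"] by simp
    also have "erase_equiv p N j \<dots> (lpow A N @ E @ lpow B N)"
      unfolding B_def True by (rule erase_equiv_context[OF erase_equiv_fill])
    finally show ?thesis .
  next
    case False
    have "erase_equiv p N j (lpow A N @ lpow B N) (lpow A N @ A @ lpow B N)"
      using erase_equiv_context[OF erase_equiv_pump[of p N j A], of "[]" "lpow B N"]
      \<comment> \<open>The extra \<open>A\<close> has to be split off on the right, next to the
        copies of \<open>B\<close>, not on the left.\<close>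
      by (simp del: concat.simps replicate.simps add: lpow_Suc_right)
    also have "erase_equiv p N j \<dots> (lpow A N @ E @ lpow B N)"
      using that False by (intro erase_equiv_context AE) simp
    finally show ?thesis .
  qed
  moreover have "\<forall>s\<in>set (lpow A N) \<union> set (lpow B N). s \<noteq> {} \<and> s \<subseteq> {..<Suc K}"
    using A B by fastforce
  moreover have "\<forall>s\<in>set E. s \<subseteq> {..<Suc K}" using E(2) by fastforce
  ultimately show ?case
    using E(1)
    by (intro exI[of _ "lpow A N @ lpow B N"] exI[of _ "lpow A N @ E @ lpow B N"])
      (simp add: ball_Un del: set_concat)
qed

section \<open>Synchronous \<open>F p\<close> is not expressible in HyperLTL\<close>

fun qcount :: "'a hyper \<Rightarrow> nat" where
  "qcount (HEx \<pi> \<phi>) = Suc (qcount \<phi>)"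
| "qcount (HAll \<pi> \<phi>) = Suc (qcount \<phi>)"
| "qcount (HBody \<psi>) = 0"

fun body_of :: "'a hyper \<Rightarrow> 'a hbody" where
  "body_of (HEx \<pi> \<phi>) = body_of \<phi>"
| "body_of (HAll \<pi> \<phi>) = body_of \<phi>"
| "body_of (HBody \<psi>) = \<psi>"

lemma hsat_b_team_irrelevant: "hsat_b T \<Pi> \<psi> = hsat_b T' \<Pi> \<psi>"
  by (induction \<psi> arbitrary: \<Pi>) auto

text \<open>Quantifiers over the two teams are matched by choosing the same colour in both. Each
  adds at most one colour to the range of \<open>g\<close>, so every assignment reaching the body
  uses fewer than \<open>K\<close> colours.\<close>

lemma hsat_colour_team_cong:
  assumes "\<And>g. finite (ran g) \<Longrightarrow> card (ran g) < K \<Longrightarrow>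
    hsat_b {} (colour_asg p g w) (body_of \<phi>) = hsat_b {} (colour_asg p g w') (body_of \<phi>)"
    and "finite (ran g)" "card (ran g) + qcount \<phi> < K"
  shows "hsat (colour_trace p w ` {..<K}) (colour_asg p g w) \<phi> =
    hsat (colour_trace p w' ` {..<K}) (colour_asg p g w') \<phi>"
  using assms
proof (induction \<phi> arbitrary: g)
  case (HBody \<psi>)
  then have "hsat_b {} (colour_asg p g w) \<psi> = hsat_b {} (colour_asg p g w') \<psi>" by simp
  then show ?case by (metis hsat.simps(3) hsat_b_team_irrelevant)
next
  case (HEx \<pi> \<phi>)
  have *: "ran (g(\<pi> := Some i)) \<subseteq> insert i (ran g)" for i by (auto simp: ran_def)
  have "finite (ran (g(\<pi> := Some i)))" "card (ran (g(\<pi> := Some i))) + qcount \<phi> < K" for i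
    using card_mono[OF _ *, of i] card_insert_le_m1[of "Suc (card (ran g))" "ran g" i]
      HEx.prems(2,3) finite_subset[OF *, of i] by auto
  then show ?case using HEx.IH HEx.prems(1) by (simp add: colour_asg_upd)
next
  case (HAll \<pi> \<phi>)
  have *: "ran (g(\<pi> := Some i)) \<subseteq> insert i (ran g)" for i by (auto simp: ran_def)
  have "finite (ran (g(\<pi> := Some i)))" "card (ran (g(\<pi> := Some i))) + qcount \<phi> < K" for i
    using card_mono[OF _ *, of i] card_insert_le_m1[of "Suc (card (ran g))" "ran g" i]
      HAll.prems(2,3) finite_subset[OF *, of i] by auto
  then show ?case using HAll.IH HAll.prems(1) by (simp add: colour_asg_upd)
qed

lemma sync_eventually_colour_team:
  "sat_s (colour_trace p w ` {..<K}) (LF (LProp p)) \<longleftrightarrow> (\<exists>n. \<forall>i<K. i \<notin> w n)"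
  by (auto simp: tshift_def tsuf_def colour_trace_def)

lemma sync_eventually_not_hyper:
  "\<not> (\<forall>T. hmodels T \<phi> \<longleftrightarrow> sat_s T (LF (LProp p)))"
proof
  assume \<phi>: "\<forall>T. hmodels T \<phi> \<longleftrightarrow> sat_s T (LF (LProp p))"
  \<comment> \<open>One colour more than there are quantifiers, so some colour always stays
    unassigned.\<close>
  define K where "K = Suc (qcount \<phi>)"
  define N where "N = hdepth (body_of \<phi>)"
  obtain u u' where u: "\<forall>s\<in>set u. s \<noteq> {} \<and> s \<subseteq> {..<K}" and u': "{} \<in> set u'"
    and equiv: "\<And>j. j < K \<Longrightarrow> erase_equiv p N j u u'"
    using erase_equiv_words[of K p N] by blast
  \<comment> \<open>The tail letter is nonempty and its colour 0 lies below \<open>K\<close>, so the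
    tail contributes no position at which \<open>p\<close> holds on the whole team.\<close>
  define w where "w = u \<frown> (\<lambda>_. {0})"
  define w' where "w' = u' \<frown> (\<lambda>_. {0})"
  have body: "hsat_b {} (colour_asg p g w) (body_of \<phi>) = hsat_b {} (colour_asg p g w') (body_of \<phi>)"
    if g: "finite (ran g)" "card (ran g) < K" for g
  proof -
    have "\<not> {..<K} \<subseteq> ran g" using card_mono[OF g(1), of "{..<K}"] g(2) by auto
    then obtain j where "j < K" "j \<notin> ran g" by auto
    then show ?thesis
      using equiv[of j, unfolded erase_equiv_def, rule_format, of g "body_of \<phi>" "{}" "[]"]
      by (simp add: N_def w_def w'_def)
  qed
  have "colour_asg p Map.empty v = (\<lambda>_. None)" for v by (simp add: colour_asg_def)
  then have "hmodels (colour_trace p w ` {..<K}) \<phi> = hmodels (colour_trace p w' ` {..<K}) \<phi>"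
    using hsat_colour_team_cong[OF body, where g = Map.empty] by (simp add: hmodels_def K_def)
  moreover have "\<not> sat_s (colour_trace p w ` {..<K}) (LF (LProp p))"
  proof -
    have "\<exists>i<K. i \<in> w n" for n
      using u by (cases "n < length u") (auto simp: w_def conc_def K_def dest!: nth_mem)
    then show ?thesis by (simp only: sync_eventually_colour_team) blast
  qed
  moreover have "sat_s (colour_trace p w' ` {..<K}) (LF (LProp p))"
  proof -
    obtain n where "n < length u'" "u' ! n = {}" using u' by (auto simp: in_set_conv_nth)
    then have "w' n = {}" by (simp add: w'_def conc_def)
    then show ?thesis by (simp only: sync_eventually_colour_team) blast
  qed
  ultimately show False using \<phi> by blast
qed

theorem mainTheorem15:
  fixes p :: "'a::finite"
  shows "(\<forall>\<pi>. (\<not> (\<exists>\<phi>. \<forall>T. sat_s T \<phi> \<longleftrightarrow> hmodels T (HEx \<pi> (HBody (HProp p \<pi>)))))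
            \<and> (\<not> (\<exists>\<phi>. \<forall>T. sat_a T \<phi> \<longleftrightarrow> hmodels T (HEx \<pi> (HBody (HProp p \<pi>))))))
   \<and> (\<not> (\<exists>\<phi>::'a hyper. hsentence \<phi> \<and> (\<forall>T. hmodels T \<phi> \<longleftrightarrow> sat_s T (LF (LProp p)))))
   \<and> (\<forall>\<phi>::'a ltl. \<exists>\<psi>. forall_hyper \<psi> \<and> (\<forall>T. sat_a T \<phi> \<longleftrightarrow> hmodels T \<psi>))
   \<and> (\<forall>\<psi>::'a hyper. forall_hyper \<psi> \<longrightarrow> (\<exists>\<phi>. \<forall>T. sat_a T \<phi> \<longleftrightarrow> hmodels T \<psi>))"
proof -
  have "\<not> hmodels {} (HEx \<pi> (HBody (HProp p \<pi>)))" for \<pi>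
    by (simp add: hmodels_def)
  then have "\<not> (\<exists>\<phi>. \<forall>T. sat_s T \<phi> \<longleftrightarrow> hmodels T (HEx \<pi> (HBody (HProp p \<pi>))))"
    and "\<not> (\<exists>\<phi>. \<forall>T. sat_a T \<phi> \<longleftrightarrow> hmodels T (HEx \<pi> (HBody (HProp p \<pi>))))" for \<pi>
    by (metis sat_s_empty, metis sat_a_empty)
  moreover have
    "\<not> (\<exists>\<phi>::'a hyper. hsentence \<phi> \<and> (\<forall>T. hmodels T \<phi> \<longleftrightarrow> sat_s T (LF (LProp p))))"
    by (rule notI, elim exE conjE, rule sync_eventually_not_hyper[THEN notE])
  ultimately show ?thesis
    by (intro conjI allI impI ltl_to_forall_hyper forall_hyper_to_ltl) assumption+
qed

end
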